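(* Assume that $\tilde M^{n+1}=(\langle\tilde U^{n+1}_i,\tilde U^{n+1}_j\rangle_H)_{i,j=1}^R$ has full rank. The discretized system consisting of the equations for the deterministic modes, $$\Big\langle\frac{\tilde U^{n+1}_j-U^n_j}{\triangle t},v_h\Big\rangle_H+\big(\mathbb E_{\hat\rho}[(\mathcal L(u^n,u^{n+1})-f^{n,n+1})Y^n_j],v_h\big)_{V'V}=0\quad\forall v_h\in V_h,\ j=1,\dots,R,$$ and for the stochastic modes, $$\frac{\tilde Y^{n+1}-Y^n}{\triangle t}\tilde M^{n+1}+\mathcal P^\perp_{\hat\rho,\mathcal Y^n}\big[(\mathcal L^*(u^n,u^{n+1})-f^{n,n+1,*},\tilde U^{n+1})_{V'V}\big]=0\quad\text{in }(L^2_{\hat\rho})^R,$$ can be equivalently reformulated as $$\langle\tilde u,v_h\rangle_{H,\hat\rho}=\langle u^{n,*},v_h\rangle_{H,\hat\rho}+\triangle t\big(\mathcal P_{\hat\rho,\mathcal Y^n}[f^{n,n+1,*}-\mathcal L^*(u^n,u^{n+1})],v_h\big)_{V'V,\hat\rho},$$ $$\langle u^{n+1,*},v_h\rangle_{H,\hat\rho}=\langle\tilde u,v_h\rangle_{H,\hat\rho}+\triangle t\big(\mathcal P^\perp_{\hat\rho,\mathcal Y^n}\big[\mathcal P_{\tilde{\mathcal U}^{n+1}}[f^{n,n+1,*}-\mathcal L^*(u^n,u^{n+1})]\big],v_h\big)_{V'V,\hat\rho}$$ for all $v_h\in V_h\otimes L^2_{\hat\rho}$, where $\tilde u=\tilde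 U^{n+1}(Y^n)^{\intercal}$.
   Context: Setting. $V,H$ are separable real Hilbert spaces forming a Gelfand triple $V\subset H\subset V'$; $(\cdot,\cdot)_{V'V}$ is the duality pairing, extending $\langle\cdot,\cdot\rangle_H$. $\hat\Gamma=\{\omega_1,\dots,\omega_{\hat N}\}$ is a finite set with weights $\lambda_k>0$, $\sum_k\lambda_k=1$, $\hat\rho=\sum_k\lambda_k\delta_{\omega_k}$; $L^2_{\hat\rho}$ is the space of real functions on $\hat\Gamma$ with $\langle v,w\rangle_{L^2_{\hat\rho}}=\sum_k\lambda_kv(\omega_k)w(\omega_k)$; $\mathbb E_{\hat\rho}[v]=\sum_k\lambda_kv(\omega_k)$ (also for vector-valued $v$); $v^*$ (also written as a superscript, $u^{n,*}$, $f^{n,n+1,*}$, $\mathcal L^*(u^n,u^{n+1})$) denotes $v-\mathbb E_{\hat\rho}[v]$. For functions on $\hat\Gamma$: $\langle v,w\rangle_{H,\hat\rho}=\sum_k\lambda_k\langle v(\omega_k),w(\omega_k)\rangle_H$, $(\mathcal K,v)_{V'V,\hat\rho}=\sum_k\lambda_k(\mathcal K(\omega_k),v(\omega_k))_{V'V}$. $V_h\subset V$ is a finite-dimensional subspace, $\dim V_h>R$, $R<\hat N$; $V_h\otimes L^2_{\hat\rho}$ is identified with the functions $\hat\Gamma\to V_h$. $u^n=\bar u^n+\sum_{j=1}^RU^n_jY^n_j$ with $\bar u^n,U^n_j\in V_h$, $Y^n_j\in L^2_{\hat\rho}$, $\langle Y^n_i,Y^n_j\rangle_{L^2_{\hat\rho}}=\delta_{ij}$,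 $\mathbb E_{\hat\rho}[Y^n_j]=0$. $\mathcal L(u^n,u^{n+1}):\hat\Gamma\to V'$ and $f^{n,n+1}:\hat\Gamma\to H$ denote an unspecified time integration of the (random, linear, bounded, coercive) operator $\mathcal L(u(t))$ and of the right-hand side $f(t)$ over $[t_n,t_{n+1}]$. The new solution has zero-mean part $u^{n+1,*}=\sum_{j=1}^R\tilde U^{n+1}_j\tilde Y^{n+1}_j$, and mean $\bar u^{n+1}\in V_h$ determined by $\langle\frac{\bar u^{n+1}-\bar u^n}{\triangle t},v_h\rangle_H+(\mathbb E_{\hat\rho}[\mathcal L(u^n,u^{n+1})-f^{n,n+1}],v_h)_{V'V}=0$ for all $v_h\in V_h$. $\tilde U^{n+1}=(\tilde U_1^{n+1},\dots,\tilde U_R^{n+1})\in(V_h)^R$, $\tilde Y^{n+1},Y^n\in(L^2_{\hat\rho})^R$ are rows, $UY^{\intercal}=\sum_jU_jY_j$, and $(\mathcal K,\tilde U^{n+1})_{V'V}$ is the row $((\mathcal K,\tilde U^{n+1}_j)_{V'V})_j$ of elements of $L^2_{\hat\rho}$. Projections: for $\mathcal K:\hat\Gamma\to V'$ (or real-valued), $\mathcal P_{\hat\rho,\mathcal Y^n}[\mathcal K]=\sum_{j=1}^R\mathbb E_{\hat\rho}[\mathcal KY^n_j]\,Y^n_j$ and $\mathcal P^\perp_{\hat\rho,\mathcal Y^n}[\mathcal K]=\mathcal K-\mathcal P_{\hat\rho,\mathcal Y^n}[\mathcal K]$, where $\mathcal Y^n=\mathrm{span}\{Y^n_1,\dots,Y^n_R\}$;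 $\mathcal P_{\tilde{\mathcal U}^{n+1}}[\mathcal K]=\sum_{i,j}(\mathcal K,\tilde U^{n+1}_i)_{V'V}\,((\tilde M^{n+1})^{-1})_{ij}\,\tilde U^{n+1}_j$ (extension of the $H$-orthogonal projection onto $\tilde{\mathcal U}^{n+1}=\mathrm{span}\{\tilde U^{n+1}_j\}$). *)

theory Defs
  imports "HOL-Analysis.Analysis"
begin

text \<open>
  The inclusion of V into H is a bounded operator, V' is the type of bounded functionals on V, and
  the duality pairing of K in V' with v in V is plain application of K to v. The embedding of H
  into V' sends h to the functional v \<mapsto> \<langle>h, \<iota> v\<rangle>, which makes the duality pairing
  an extension of the inner product of H.
\<close>

definition gelfand_triple ::
    "('v::{real_inner,complete_space} \<Rightarrow>\<^sub>L 'h::{real_inner,complete_space}) \<Rightarrow> bool" where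
  "gelfand_triple \<iota> \<longleftrightarrow>
     separable_space (euclidean :: 'v topology) \<and> separable_space (euclidean :: 'h topology) \<and>
     inj (blinfun_apply \<iota>) \<and> closure (range (blinfun_apply \<iota>)) = UNIV"

definition H_to_dual ::
    "('v::real_inner \<Rightarrow>\<^sub>L 'h::real_inner) \<Rightarrow> 'h \<Rightarrow> ('v \<Rightarrow>\<^sub>L real)" where
  "H_to_dual \<iota> h = blinfun_inner_right h o\<^sub>L \<iota>"

text \<open>
  The finite sample set is the finite type \<open>'w\<close> with weights \<open>lam\<close>, so the random variables
  (the elements of the discrete L2 space when real-valued) are all functions on \<open>'w\<close>. As the
  weights are positive, equality in L2 is equality of functions.
\<close>

definition expect :: "('w::finite \<Rightarrow> real) \<Rightarrow> ('w \<Rightarrow> 'a::real_vector) \<Rightarrow> 'a" where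
  "expect lam v = (\<Sum>\<omega>\<in>UNIV. lam \<omega> *\<^sub>R v \<omega>)"

definition star :: "('w::finite \<Rightarrow> real) \<Rightarrow> ('w \<Rightarrow> 'a::real_vector) \<Rightarrow> 'w \<Rightarrow> 'a" where
  "star lam v = (\<lambda>\<omega>. v \<omega> - expect lam v)"

definition inner_L2 :: "('w::finite \<Rightarrow> real) \<Rightarrow> ('w \<Rightarrow> real) \<Rightarrow> ('w \<Rightarrow> real) \<Rightarrow> real" where
  "inner_L2 lam v w = (\<Sum>\<omega>\<in>UNIV. lam \<omega> * v \<omega> * w \<omega>)"

definition inner_Hrho ::
    "('w::finite \<Rightarrow> real) \<Rightarrow> ('v::real_inner \<Rightarrow>\<^sub>L 'h::real_inner) \<Rightarrow> ('w \<Rightarrow> 'v) \<Rightarrow> ('w \<Rightarrow> 'v) \<Rightarrow> real" where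
  "inner_Hrho lam \<iota> v w = (\<Sum>\<omega>\<in>UNIV. lam \<omega> * (blinfun_apply \<iota> (v \<omega>) \<bullet> blinfun_apply \<iota> (w \<omega>)))"

definition pairing_rho ::
    "('w::finite \<Rightarrow> real) \<Rightarrow> ('w \<Rightarrow> ('v::real_normed_vector \<Rightarrow>\<^sub>L real)) \<Rightarrow> ('w \<Rightarrow> 'v) \<Rightarrow> real" where
  "pairing_rho lam K v = (\<Sum>\<omega>\<in>UNIV. lam \<omega> * blinfun_apply (K \<omega>) (v \<omega>))"

text \<open>
  Rows of R modes are families over a finite type \<open>'r\<close> with R elements;
  \<open>low_rank U Y\<close> is the random vector \<open>\<Sum>j. U\<^sub>j Y\<^sub>j\<close>.
\<close>

definition low_rank ::
    "('r::finite \<Rightarrow> 'v::real_vector) \<Rightarrow> ('r \<Rightarrow> 'w \<Rightarrow> real) \<Rightarrow> 'w \<Rightarrow> 'v" where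
  "low_rank U Y = (\<lambda>\<omega>. \<Sum>j\<in>UNIV. Y j \<omega> *\<^sub>R U j)"

definition gram ::
    "('v::real_inner \<Rightarrow>\<^sub>L 'h::real_inner) \<Rightarrow> ('r::finite \<Rightarrow> 'v) \<Rightarrow> real^'r^'r" where
  "gram \<iota> U = (\<chi> i j. blinfun_apply \<iota> (U i) \<bullet> blinfun_apply \<iota> (U j))"

definition proj_Y ::
    "('w::finite \<Rightarrow> real) \<Rightarrow> ('r::finite \<Rightarrow> 'w \<Rightarrow> real) \<Rightarrow> ('w \<Rightarrow> 'a::real_vector) \<Rightarrow> 'w \<Rightarrow> 'a" where
  "proj_Y lam Y K = (\<lambda>\<omega>. \<Sum>j\<in>UNIV. Y j \<omega> *\<^sub>R expect lam (\<lambda>\<eta>. Y j \<eta> *\<^sub>R K \<eta>))"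

definition proj_Y_perp ::
    "('w::finite \<Rightarrow> real) \<Rightarrow> ('r::finite \<Rightarrow> 'w \<Rightarrow> real) \<Rightarrow> ('w \<Rightarrow> 'a::real_vector) \<Rightarrow> 'w \<Rightarrow> 'a" where
  "proj_Y_perp lam Y K = (\<lambda>\<omega>. K \<omega> - proj_Y lam Y K \<omega>)"

definition proj_U ::
    "('v::real_inner \<Rightarrow>\<^sub>L 'h::real_inner) \<Rightarrow> ('r::finite \<Rightarrow> 'v) \<Rightarrow> ('w \<Rightarrow> ('v \<Rightarrow>\<^sub>L real)) \<Rightarrow> 'w \<Rightarrow> 'v" where
  "proj_U \<iota> U K = (\<lambda>\<omega>. \<Sum>i\<in>UNIV. \<Sum>j\<in>UNIV.
     (blinfun_apply (K \<omega>) (U i) * matrix_inv (gram \<iota> U) $ i $ j) *\<^sub>R U j)"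

end

theory Submission
  imports Defs
begin

text \<open>
  Testing with functions supported at a single sample turns the two reformulated equations into
  equations in the dual of \<open>Vh\<close> for each sample. The first one says
  \<open>\<Sum>j. Y\<^sub>j (\<omega>) a\<^sub>j = 0\<close>, where \<open>a\<^sub>j = 0\<close> is the equation for the j-th deterministic mode, so
  orthonormality of \<open>Y\<close> separates the modes. In the second one both sides are combinations of
  \<open>Ut\<close>, so it suffices to test with \<open>Ut\<close> itself, which yields the stochastic equation; the way
  back is multiplication by the inverse of the Gram matrix.
\<close>

text \<open>A test function equal to \<open>x\<close> at one sample and 0 elsewhere leaves a single
  term in each sum, because \<open>A\<close> and \<open>B\<close> vanish at 0; the positive weight
  of that sample then cancels.\<close>

lemma test_pointwise:
  fixes lam :: "'w::finite \<Rightarrow> real" and S :: "'v::real_vector set" and A B :: "'w \<Rightarrow> 'v \<Rightarrow> real"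
  assumes lam: "\<And>\<omega>. lam \<omega> > 0" and S: "0 \<in> S"
    and A0: "\<And>\<omega>. A \<omega> 0 = 0" and B0: "\<And>\<omega>. B \<omega> 0 = 0"
  shows "(\<forall>v. range v \<subseteq> S \<longrightarrow> (\<Sum>\<omega>\<in>UNIV. lam \<omega> * A \<omega> (v \<omega>)) = (\<Sum>\<omega>\<in>UNIV. lam \<omega> * B \<omega> (v \<omega>)))
     \<longleftrightarrow> (\<forall>\<omega>. \<forall>x\<in>S. A \<omega> x = B \<omega> x)" (is "?L \<longleftrightarrow> ?R")
proof
  assume L: ?L
  show ?R
  proof (intro allI ballI)
    fix \<omega> x assume x: "x \<in> S"
    define v where "v = (\<lambda>\<eta>::'w. if \<eta> = \<omega> then x else 0)"
    have "range v \<subseteq> S" using x S by (auto simp: v_def)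
    then have eq: "(\<Sum>\<eta>\<in>UNIV. lam \<eta> * A \<eta> (v \<eta>)) = (\<Sum>\<eta>\<in>UNIV. lam \<eta> * B \<eta> (v \<eta>))"
      using L by blast
    have single: "(\<Sum>\<eta>\<in>UNIV. lam \<eta> * C \<eta> (v \<eta>)) = lam \<omega> * C \<omega> x"
      if "\<And>\<eta>. C \<eta> 0 = 0" for C :: "'w \<Rightarrow> 'v \<Rightarrow> real"
    proof -
      have "(\<Sum>\<eta>\<in>UNIV. lam \<eta> * C \<eta> (v \<eta>)) = (\<Sum>\<eta>\<in>UNIV. if \<eta> = \<omega> then lam \<eta> * C \<eta> x else 0)"
        by (rule sum.cong) (simp_all add: v_def that)
      then show ?thesis by simp
    qed
    show "A \<omega> x = B \<omega> x"
      using eq single[of A] single[of B] A0 B0 lam[of \<omega>] by simp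
  qed
next
  assume R: ?R
  show ?L
  proof (intro allI impI)
    fix v :: "'w \<Rightarrow> 'v" assume "range v \<subseteq> S"
    then have "v \<omega> \<in> S" for \<omega> by auto
    then show "(\<Sum>\<omega>\<in>UNIV. lam \<omega> * A \<omega> (v \<omega>)) = (\<Sum>\<omega>\<in>UNIV. lam \<omega> * B \<omega> (v \<omega>))"
      using R by simp
  qed
qed

text \<open>Taking the weighted inner product of the combination with \<open>Y i\<close> isolates
  the coefficient \<open>a i\<close>.\<close>

lemma orthonormal_combination_eq_0_iff:
  fixes Y :: "'r::finite \<Rightarrow> 'w::finite \<Rightarrow> real" and a :: "'r \<Rightarrow> real"
  assumes orth: "\<And>i j. inner_L2 lam (Y i) (Y j) = (if i = j then 1 else 0)"
  shows "(\<forall>\<omega>. (\<Sum>j\<in>UNIV. Y j \<omega> * a j) = 0) \<longleftrightarrow> (\<forall>j. a j = 0)"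
proof
  assume L: "\<forall>\<omega>. (\<Sum>j\<in>UNIV. Y j \<omega> * a j) = 0"
  show "\<forall>j. a j = 0"
  proof
    fix i
    have "0 = (\<Sum>\<omega>\<in>UNIV. lam \<omega> * Y i \<omega> * (\<Sum>j\<in>UNIV. Y j \<omega> * a j))"
      using L by simp
    also have "\<dots> = (\<Sum>j\<in>UNIV. inner_L2 lam (Y i) (Y j) * a j)"
      unfolding inner_L2_def sum_distrib_left sum_distrib_right
      by (subst sum.swap) (simp add: mult_ac)
    also have "\<dots> = (\<Sum>j\<in>UNIV. if i = j then a j else 0)"
      by (rule sum.cong) (simp_all add: orth)
    also have "\<dots> = a i" by simp
    finally show "a i = 0" by simp
  qed
qed simp

lemma expect_linear:
  assumes "linear T"
  shows "T (expect lam v) = expect lam (\<lambda>\<omega>. T (v \<omega>))"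
  unfolding expect_def by (simp add: linear_sum[OF assms] linear_scale[OF assms])

lemma expect_low_rank:
  assumes "\<And>j. expect lam (Y j) = 0"
  shows "expect lam (low_rank U Y) = 0"
proof -
  have "expect lam (low_rank U Y) = (\<Sum>j\<in>UNIV. expect lam (Y j) *\<^sub>R U j)"
    unfolding expect_def low_rank_def scaleR_sum_right scaleR_sum_left
    by (subst sum.swap) simp
  then show ?thesis using assms by simp
qed

text \<open>Used to identify the zero-mean part of the old solution with its low-rank part.\<close>

lemma star_const_add:
  assumes "(\<Sum>\<omega>\<in>UNIV. lam \<omega>) = 1" and "expect lam w = 0"
  shows "star lam (\<lambda>\<omega>. c + w \<omega>) = w"
proof -
  have "expect lam (\<lambda>\<omega>. c + w \<omega>) = (\<Sum>\<omega>\<in>UNIV. lam \<omega>) *\<^sub>R c + expect lam w"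
    unfolding expect_def by (simp add: scaleR_right_distrib sum.distrib scaleR_sum_left)
  then show ?thesis using assms by (simp add: star_def)
qed

text \<open>Centering changes \<open>F - K\<close> by a vector independent of the sample, and the
  zero-mean \<open>Z\<close> annihilates it. This reconciles the uncentered data in the
  deterministic equations with the centered data in the reformulation; the minus sign comes from
  exchanging \<open>F\<close> and \<open>K\<close>.\<close>

lemma expect_scaleR_star_diff:
  assumes "expect lam Z = 0"
  shows "expect lam (\<lambda>\<omega>. Z \<omega> *\<^sub>R (star lam F \<omega> - star lam K \<omega>))
    = - expect lam (\<lambda>\<omega>. Z \<omega> *\<^sub>R (K \<omega> - F \<omega>))"
proof -
  have "expect lam (\<lambda>\<omega>. Z \<omega> *\<^sub>R (star lam F \<omega> - star lam K \<omega>))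
      = expect lam (\<lambda>\<omega>. Z \<omega> *\<^sub>R (F \<omega> - K \<omega>)) - expect lam Z *\<^sub>R (expect lam F - expect lam K)"
    unfolding expect_def[of lam Z] expect_def[of lam "\<lambda>\<omega>. Z \<omega> *\<^sub>R h \<omega>" for h] star_def
    by (simp add: scaleR_sum_left flip: sum_subtractf) (simp add: algebra_simps)
  also have "\<dots> = - expect lam (\<lambda>\<omega>. Z \<omega> *\<^sub>R (K \<omega> - F \<omega>))"
    using assms unfolding expect_def[of lam "\<lambda>\<omega>. Z \<omega> *\<^sub>R h \<omega>" for h]
    by (simp add: algebra_simps flip: sum_negf)
  finally show ?thesis .
qed

text \<open>The projection only forms real linear combinations of the values of \<open>K\<close> at
  different samples, so any linear map on the values commutes with it.\<close>

lemma proj_Y_perp_linear: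
  assumes "linear T"
  shows "T (proj_Y_perp lam Y K \<omega>) = proj_Y_perp lam Y (\<lambda>\<eta>. T (K \<eta>)) \<omega>"
  unfolding proj_Y_perp_def proj_Y_def
  by (simp add: linear_diff[OF assms] linear_sum[OF assms] linear_scale[OF assms]
      expect_linear[OF assms])

text \<open>Coefficients are treated as row vectors, matching the right multiplication by the Gram
  matrix in the stochastic equation.\<close>

lemma inner_lincomb_gram:
  "blinfun_apply \<iota> (\<Sum>j\<in>UNIV. x $ j *\<^sub>R U j) \<bullet> blinfun_apply \<iota> (U k) = (x v* gram \<iota> U) $ k"
  by (simp add: blinfun.sum_right blinfun.scaleR_right inner_sum_left vector_matrix_mult_def
      gram_def mult.commute)

lemma proj_U_eq_lincomb:
  "proj_U \<iota> U K \<omega> =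
     (\<Sum>j\<in>UNIV. ((\<chi> i. blinfun_apply (K \<omega>) (U i)) v* matrix_inv (gram \<iota> U)) $ j *\<^sub>R U j)"
  unfolding proj_U_def
  by (subst sum.swap) (simp add: vector_matrix_mult_def scaleR_sum_left mult.commute)

lemma invertible_if_full_rank:
  fixes A :: "real^'n^'n"
  assumes "rank A = CARD('n)"
  shows "invertible A"
  using assms full_rank_injective invertible_left_inverse matrix_left_invertible_injective
  by (metis (no_types))

text \<open>At every sample \<open>proj_U\<close> applies one and the same linear map to the row of
  pairings with the modes. The stochastic projection passes through this map and lands on the scalar
  pairings that occur in the stochastic equation.\<close>

lemma proj_Y_perp_proj_U:
  "proj_Y_perp lam Y (proj_U \<iota> U K) \<omega> =
     (\<Sum>j\<in>UNIV. ((\<chi> i. proj_Y_perp lam Y (\<lambda>\<eta>. blinfun_apply (K \<eta>) (U i)) \<omega>)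
        v* matrix_inv (gram \<iota> U)) $ j *\<^sub>R U j)"
proof -
  define T where "T x = (\<Sum>j\<in>UNIV. (x v* matrix_inv (gram \<iota> U)) $ j *\<^sub>R U j)" for x
  have T: "linear T"
    unfolding T_def
    by (intro linearI) (simp_all add: vector_matrix_left_distrib scaleR_vector_matrix_assoc
        scaleR_left_distrib sum.distrib scaleR_sum_right)
  have comp: "proj_Y_perp lam Y k \<omega> $ i = proj_Y_perp lam Y (\<lambda>\<eta>. k \<eta> $ i) \<omega>" for k :: "_ \<Rightarrow> real^_" and i
    by (rule proj_Y_perp_linear) (intro linearI, simp_all)
  have "proj_U \<iota> U K = (\<lambda>\<eta>. T (\<chi> i. blinfun_apply (K \<eta>) (U i)))"
    by (rule ext) (simp add: proj_U_eq_lincomb T_def)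
  then have "proj_Y_perp lam Y (proj_U \<iota> U K) \<omega>
      = T (proj_Y_perp lam Y (\<lambda>\<eta>. \<chi> i. blinfun_apply (K \<eta>) (U i)) \<omega>)"
    by (simp add: proj_Y_perp_linear[OF T])
  also have "proj_Y_perp lam Y (\<lambda>\<eta>. \<chi> i. blinfun_apply (K \<eta>) (U i)) \<omega>
      = (\<chi> i. proj_Y_perp lam Y (\<lambda>\<eta>. blinfun_apply (K \<eta>) (U i)) \<omega>)"
    by (simp add: vec_eq_iff comp)
  finally show ?thesis by (simp add: T_def)
qed

lemma deterministic_modes_iff:
  fixes lam :: "'w::finite \<Rightarrow> real" and Y :: "'r::finite \<Rightarrow> 'w \<Rightarrow> real" and U Ut :: "'r \<Rightarrow> 'v::real_inner"
    and \<iota> :: "'v \<Rightarrow>\<^sub>L 'h::real_inner" and F K :: "'w \<Rightarrow> ('v \<Rightarrow>\<^sub>L real)"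
  assumes lam: "\<And>\<omega>. lam \<omega> > 0" and dt: "dt > 0" and S: "0 \<in> S"
    and orth: "\<And>i j. inner_L2 lam (Y i) (Y j) = (if i = j then 1 else 0)"
    and mean: "\<And>j. expect lam (Y j) = 0"
  shows "(\<forall>j. \<forall>v\<in>S. blinfun_apply \<iota> ((Ut j - U j) /\<^sub>R dt) \<bullet> blinfun_apply \<iota> v
        + blinfun_apply (expect lam (\<lambda>\<omega>. Y j \<omega> *\<^sub>R (K \<omega> - F \<omega>))) v = 0) \<longleftrightarrow>
     (\<forall>v. range v \<subseteq> S \<longrightarrow> inner_Hrho lam \<iota> (low_rank Ut Y) v
           = inner_Hrho lam \<iota> (low_rank U Y) v
             + dt * pairing_rho lam (proj_Y lam Y (\<lambda>\<omega>. star lam F \<omega> - star lam K \<omega>)) v)"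
    (is "_ \<longleftrightarrow> ?R")
proof -
  define e where "e j = expect lam (\<lambda>\<omega>. Y j \<omega> *\<^sub>R (K \<omega> - F \<omega>))" for j
  \<comment> \<open>\<open>a x j\<close> is the residual of the j-th deterministic equation tested
    with \<open>x\<close>; \<open>A\<close> and \<open>B\<close> are the integrands of the two sides
    of the reformulated equation.\<close>
  define a where "a x j = blinfun_apply \<iota> ((Ut j - U j) /\<^sub>R dt) \<bullet> blinfun_apply \<iota> x
      + blinfun_apply (e j) x" for x j
  define A where "A \<omega> x = blinfun_apply \<iota> (low_rank Ut Y \<omega>) \<bullet> blinfun_apply \<iota> x" for \<omega> x
  define B where "B \<omega> x = blinfun_apply \<iota> (low_rank U Y \<omega>) \<bullet> blinfun_apply \<iota> x
      + dt * blinfun_apply (proj_Y lam Y (\<lambda>\<omega>. star lam F \<omega> - star lam K \<omega>) \<omega>) x" for \<omega> x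
  have proj: "proj_Y lam Y (\<lambda>\<omega>. star lam F \<omega> - star lam K \<omega>) \<omega> = (\<Sum>j\<in>UNIV. Y j \<omega> *\<^sub>R (- e j))" for \<omega>
    unfolding proj_Y_def e_def by (simp add: expect_scaleR_star_diff[OF mean])
  have cancel: "dt * (inverse dt * z) = z" for z using dt by simp
  \<comment> \<open>Multiplying the residuals by \<open>dt\<close> clears the difference quotient,
    and the sign in \<open>proj\<close> makes the operator terms agree.\<close>
  have "A \<omega> x - B \<omega> x = dt * (\<Sum>j\<in>UNIV. Y j \<omega> * a x j)" for \<omega> x
    by (simp add: A_def B_def a_def proj low_rank_def blinfun.sum_right blinfun.sum_left
        blinfun.scaleR_right blinfun.scaleR_left blinfun.diff_right blinfun.minus_left
        inner_sum_left inner_diff_left sum_distrib_left sum_subtractf sum.distrib sum_negf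
        algebra_simps cancel)
  then have pt: "A \<omega> x = B \<omega> x \<longleftrightarrow> (\<Sum>j\<in>UNIV. Y j \<omega> * a x j) = 0" for \<omega> x
    using dt by (metis eq_iff_diff_eq_0 less_irrefl mult_eq_0_iff)
  have "?R \<longleftrightarrow> (\<forall>v. range v \<subseteq> S \<longrightarrow>
      (\<Sum>\<omega>\<in>UNIV. lam \<omega> * A \<omega> (v \<omega>)) = (\<Sum>\<omega>\<in>UNIV. lam \<omega> * B \<omega> (v \<omega>)))"
    by (simp add: inner_Hrho_def pairing_rho_def A_def B_def distrib_left sum.distrib
        sum_distrib_left mult_ac)
  also have "\<dots> \<longleftrightarrow> (\<forall>\<omega>. \<forall>x\<in>S. A \<omega> x = B \<omega> x)"
    by (rule test_pointwise[OF lam S]) (simp_all add: A_def B_def)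
  \<comment> \<open>With the test vector \<open>x\<close> fixed first, the coefficients
    \<open>a x j\<close> are real numbers that do not depend on the sample, so orthonormality
    applies.\<close>
  also have "\<dots> \<longleftrightarrow> (\<forall>x\<in>S. \<forall>j. a x j = 0)"
    unfolding pt using orthonormal_combination_eq_0_iff[OF orth] by blast
  finally show ?thesis by (auto simp: a_def e_def)
qed

text \<open>\<open>G\<close> stands for the centered right-hand side minus the centered operator,
  hence \<open>- G\<close> in the stochastic equation. At each sample both formulations reduce to
  one linear system with the Gram matrix.\<close>

lemma stochastic_modes_iff:
  fixes lam :: "'w::finite \<Rightarrow> real" and Y Yt :: "'r::finite \<Rightarrow> 'w \<Rightarrow> real" and Ut :: "'r \<Rightarrow> 'v::real_inner"
    and \<iota> :: "'v \<Rightarrow>\<^sub>L 'h::real_inner" and G :: "'w \<Rightarrow> ('v \<Rightarrow>\<^sub>L real)"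
  assumes lam: "\<And>\<omega>. lam \<omega> > 0" and dt: "dt > 0" and S: "0 \<in> S" and Ut: "\<And>j. Ut j \<in> S"
    and rank: "rank (gram \<iota> Ut) = CARD('r)"
  shows "(\<forall>j \<omega>. (\<Sum>i\<in>UNIV. (Yt i \<omega> - Y i \<omega>) / dt * gram \<iota> Ut $ i $ j)
           + proj_Y_perp lam Y (\<lambda>\<eta>. blinfun_apply (- G \<eta>) (Ut j)) \<omega> = 0) \<longleftrightarrow>
     (\<forall>v. range v \<subseteq> S \<longrightarrow> inner_Hrho lam \<iota> (low_rank Ut Yt) v
           = inner_Hrho lam \<iota> (low_rank Ut Y) v
             + dt * pairing_rho lam (\<lambda>\<omega>. H_to_dual \<iota> (blinfun_apply \<iota>
                   (proj_Y_perp lam Y (proj_U \<iota> Ut G) \<omega>))) v)"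
    (is "?L \<longleftrightarrow> ?R")
proof -
  let ?M = "gram \<iota> Ut"
  \<comment> \<open>\<open>d\<close> is the difference quotient of the stochastic modes,
    \<open>r\<close> the projected pairings of \<open>G\<close> with the modes \<open>Ut\<close>,
    and \<open>c\<close> the solution of the linear system with the Gram matrix and right-hand side
    \<open>r\<close>.\<close>
  define d where "d \<omega> = (\<chi> j. (Yt j \<omega> - Y j \<omega>) / dt)" for \<omega>
  define r where "r \<omega> = (\<chi> j. proj_Y_perp lam Y (\<lambda>\<eta>. blinfun_apply (G \<eta>) (Ut j)) \<omega>)" for \<omega>
  define c where "c \<omega> = r \<omega> v* matrix_inv ?M" for \<omega>
  define A where "A \<omega> x = blinfun_apply \<iota> (low_rank Ut Yt \<omega>) \<bullet> blinfun_apply \<iota> x" for \<omega> x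
  define B where "B \<omega> x = blinfun_apply \<iota> (low_rank Ut Y \<omega>) \<bullet> blinfun_apply \<iota> x
      + dt * (blinfun_apply \<iota> (\<Sum>j\<in>UNIV. c \<omega> $ j *\<^sub>R Ut j) \<bullet> blinfun_apply \<iota> x)" for \<omega> x
  have inv: "?M ** matrix_inv ?M = mat 1" "matrix_inv ?M ** ?M = mat 1"
    using someI_ex[OF invertible_if_full_rank[OF rank, unfolded invertible_def]]
    unfolding matrix_inv_def by blast+
  have "c \<omega> v* ?M = r \<omega>" for \<omega>
    by (simp add: c_def vector_matrix_mul_assoc inv)
  moreover have "d \<omega> = (d \<omega> v* ?M) v* matrix_inv ?M" for \<omega>
    by (simp add: vector_matrix_mul_assoc inv)
  ultimately have solve: "d \<omega> v* ?M = r \<omega> \<longleftrightarrow> d \<omega> = c \<omega>" for \<omega>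
    unfolding c_def by metis
  have perp_minus: "proj_Y_perp lam Y (\<lambda>\<eta>. - k \<eta>) \<omega> = - proj_Y_perp lam Y k \<omega>" for k :: "'w \<Rightarrow> real" and \<omega>
    by (rule proj_Y_perp_linear[symmetric]) (intro linearI, simp_all)
  \<comment> \<open>The projection of the pairings with \<open>- G\<close> is \<open>- r\<close>, so
    the stochastic equation reads \<open>d \<omega> v* ?M = r \<omega>\<close>.\<close>
  have "?L \<longleftrightarrow> (\<forall>\<omega>. d \<omega> v* ?M = r \<omega>)"
    by (auto simp: vec_eq_iff d_def r_def vector_matrix_mult_def perp_minus blinfun.minus_left
        mult.commute)
  have Yt: "Yt j \<omega> = Y j \<omega> + dt * d \<omega> $ j" for j \<omega>
    using dt by (simp add: d_def)
  \<comment> \<open>The discrepancy at a sample is \<open>dt\<close> times the H inner product of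
    \<open>x\<close> with a combination of the modes, whose coefficients are
    \<open>d - c\<close>.\<close>
  have AB: "A \<omega> x - B \<omega> x
      = dt * (blinfun_apply \<iota> (\<Sum>j\<in>UNIV. (d \<omega> - c \<omega>) $ j *\<^sub>R Ut j) \<bullet> blinfun_apply \<iota> x)" for \<omega> x
    by (simp add: A_def B_def low_rank_def Yt blinfun.sum_right blinfun.scaleR_right
        blinfun.add_right blinfun.diff_right inner_add_left inner_diff_left
        inner_sum_left sum_distrib_left sum.distrib sum_subtractf algebra_simps)
  have pt: "(\<forall>x\<in>S. A \<omega> x = B \<omega> x) \<longleftrightarrow> d \<omega> v* ?M = r \<omega>" for \<omega>
  proof
    assume L: "\<forall>x\<in>S. A \<omega> x = B \<omega> x"
    \<comment> \<open>The modes \<open>Ut k\<close> are admissible tests since they lie in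
      \<open>S\<close>; they yield all coordinates of \<open>(d - c) v* ?M\<close>, and inverting
      the Gram matrix gives \<open>d = c\<close>.\<close>
    have "((d \<omega> - c \<omega>) v* ?M) $ k = 0" for k
      using AB[of \<omega> "Ut k"] L Ut[of k] dt unfolding inner_lincomb_gram by simp
    then have "(d \<omega> - c \<omega>) v* ?M = 0" by (simp add: vec_eq_iff)
    then have "((d \<omega> - c \<omega>) v* ?M) v* matrix_inv ?M = 0" by simp
    then show "d \<omega> v* ?M = r \<omega>"
      unfolding solve by (simp add: vector_matrix_mul_assoc inv)
  next
    assume "d \<omega> v* ?M = r \<omega>"
    then show "\<forall>x\<in>S. A \<omega> x = B \<omega> x" using AB[of \<omega>] unfolding solve by simp
  qed
  \<comment> \<open>The projected term takes values in V, so through \<open>H_to_dual\<close> its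
    duality pairing becomes an inner product in H.\<close>
  have "?R \<longleftrightarrow> (\<forall>v. range v \<subseteq> S \<longrightarrow>
      (\<Sum>\<omega>\<in>UNIV. lam \<omega> * A \<omega> (v \<omega>)) = (\<Sum>\<omega>\<in>UNIV. lam \<omega> * B \<omega> (v \<omega>)))"
    unfolding proj_Y_perp_proj_U
    by (simp add: inner_Hrho_def pairing_rho_def H_to_dual_def A_def B_def c_def r_def
        distrib_left sum.distrib sum_distrib_left mult_ac)
  also have "\<dots> \<longleftrightarrow> (\<forall>\<omega>. \<forall>x\<in>S. A \<omega> x = B \<omega> x)"
    by (rule test_pointwise[OF lam S]) (simp_all add: A_def B_def)
  also have "\<dots> \<longleftrightarrow> ?L" unfolding pt \<open>?L \<longleftrightarrow> _\<close> ..
  finally show ?thesis by simp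
qed

theorem lemma4p16:
  fixes \<iota> :: "'v::{real_inner,complete_space} \<Rightarrow>\<^sub>L 'h::{real_inner,complete_space}"
    and lam :: "'w::finite \<Rightarrow> real"
    and Vh :: "'v set"
    and dt :: real
    and Lop :: "('w \<Rightarrow> 'v) \<Rightarrow> ('w \<Rightarrow> 'v) \<Rightarrow> 'w \<Rightarrow> ('v \<Rightarrow>\<^sub>L real)"
    and f :: "'w \<Rightarrow> 'h"
    and ubar ubar_new :: 'v
    and U Ut :: "'r::finite \<Rightarrow> 'v"
    and Y Yt :: "'r \<Rightarrow> 'w \<Rightarrow> real"
    and u u_new u_new_star ut :: "'w \<Rightarrow> 'v"
    and F K :: "'w \<Rightarrow> ('v \<Rightarrow>\<^sub>L real)"
  assumes "gelfand_triple \<iota>"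
    and "\<And>\<omega>. lam \<omega> > 0" and "(\<Sum>\<omega>\<in>UNIV. lam \<omega>) = 1"
    and "dt > 0"
    and "subspace Vh" and "\<exists>B. finite B \<and> Vh = span B"
    and "dim Vh > CARD('r)" and "CARD('r) < CARD('w)"
    \<comment> \<open>the old solution\<close>
    and "ubar \<in> Vh" and "\<And>j. U j \<in> Vh"
    and "\<And>i j. inner_L2 lam (Y i) (Y j) = (if i = j then 1 else 0)"
    and "\<And>j. expect lam (Y j) = 0"
    and "u = (\<lambda>\<omega>. ubar + low_rank U Y \<omega>)"
    \<comment> \<open>the new solution\<close>
    and "ubar_new \<in> Vh" and "\<And>j. Ut j \<in> Vh"
    and "u_new_star = low_rank Ut Yt"
    and "u_new = (\<lambda>\<omega>. ubar_new + u_new_star \<omega>)"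
    and "ut = low_rank Ut Y"
    \<comment> \<open>the time-integrated operator, and the right-hand side as a functional in V'\<close>
    and "K = Lop u u_new"
    and "F = (\<lambda>\<omega>. H_to_dual \<iota> (f \<omega>))"
    \<comment> \<open>the equation for the new mean\<close>
    and "\<And>v. v \<in> Vh \<Longrightarrow>
      blinfun_apply \<iota> ((ubar_new - ubar) /\<^sub>R dt) \<bullet> blinfun_apply \<iota> v
        + blinfun_apply (expect lam (\<lambda>\<omega>. K \<omega> - F \<omega>)) v = 0"
    and "rank (gram \<iota> Ut) = CARD('r)"
  shows
    "((\<forall>j. \<forall>v\<in>Vh.
         blinfun_apply \<iota> ((Ut j - U j) /\<^sub>R dt) \<bullet> blinfun_apply \<iota> v
           + blinfun_apply (expect lam (\<lambda>\<omega>. Y j \<omega> *\<^sub>R (K \<omega> - F \<omega>))) v = 0) \<and>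
      (\<forall>j \<omega>.
         (\<Sum>i\<in>UNIV. (Yt i \<omega> - Y i \<omega>) / dt * gram \<iota> Ut $ i $ j)
           + proj_Y_perp lam Y (\<lambda>\<eta>. blinfun_apply (star lam K \<eta> - star lam F \<eta>) (Ut j)) \<omega> = 0))
     \<longleftrightarrow>
     ((\<forall>v. range v \<subseteq> Vh \<longrightarrow>
         inner_Hrho lam \<iota> ut v
           = inner_Hrho lam \<iota> (star lam u) v
             + dt * pairing_rho lam (proj_Y lam Y (\<lambda>\<omega>. star lam F \<omega> - star lam K \<omega>)) v) \<and>
      (\<forall>v. range v \<subseteq> Vh \<longrightarrow>
         inner_Hrho lam \<iota> u_new_star v
           = inner_Hrho lam \<iota> ut v
             + dt * pairing_rho lam
                 (\<lambda>\<omega>. H_to_dual \<iota> (blinfun_apply \<iota>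
                   (proj_Y_perp lam Y (proj_U \<iota> Ut (\<lambda>\<eta>. star lam F \<eta> - star lam K \<eta>)) \<omega>))) v))"
proof -
  have S: "0 \<in> Vh" using \<open>subspace Vh\<close> by (rule subspace_0)
  have "star lam u = low_rank U Y"
    unfolding assms(13) by (intro star_const_add expect_low_rank assms)
  moreover have "star lam K \<eta> - star lam F \<eta> = - (star lam F \<eta> - star lam K \<eta>)" for \<eta>
    by simp
  ultimately show ?thesis
    unfolding \<open>ut = _\<close> \<open>u_new_star = _\<close>
    \<comment> \<open>Each of the two equations is equivalent to its own reformulation, so the
      conjunctions match componentwise.\<close>
    using deterministic_modes_iff[OF assms(2) \<open>dt > 0\<close> S assms(11,12), of \<iota> Ut U K F]
      stochastic_modes_iff[OF assms(2) \<open>dt > 0\<close> S assms(15,22),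
        where Yt = Yt and Y = Y and G = "\<lambda>\<eta>. star lam F \<eta> - star lam K \<eta>"]
    by (simp only:)
qed

end
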